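(* Let $\lambda$ be an integer partition, let $\mathcal{P}=\mathcal{P}(\lambda)$, let $N$ be the number of cells in the border strip $B(\lambda)$, and let $C$ be the number of corner cells in $B(\lambda)$. Then $\dim I_T(\mathcal{P})=\dim A_T(\mathcal{P})=N-C$.
   Context: An integer partition is a finite non-increasing sequence $\lambda=(\lambda_1,\dots,\lambda_\ell)$ of positive integers. Its Ferrers diagram is $F(\lambda)=\{(i,j):1\le i\le\ell,\ 1\le j\le\lambda_i\}$. The border strip is $B(\lambda)=\{(i,j)\in F(\lambda):(i+1,j+1)\notin F(\lambda)\}$. A cell $(i,j)\in B(\lambda)$ is a corner cell if $(i+1,j)\in B(\lambda)$ and $(i,j+1)\in B(\lambda)$. The poset $\mathcal{P}(\lambda)$ has underlying set $F(\lambda)$ with $(i,j)\preceq(k,m)$ iff $i\le k$ and $j\le m$. For a finite poset $\mathcal{P}$, $\mathcal{J}(\mathcal{P})$ is the set of order ideals (down-closed subsets) of $\mathcal{P}$. For $p\in\mathcal{P}$ define real-valued functions on $\mathcal{J}(\mathcal{P})$: $\mathbf{1}_p(I)=1$ if $p\in I$ and $0$ otherwise; $\mathcal{T}_p^-(I)=1$ if $p$ is a maximal element of $I$ and $0$ otherwise; $\mathcal{T}_p^+(I)=1$ if $p\notin I$ and $I\cup\{p\}\in\mathcal{J}(\mathcal{P})$, and $0$ otherwise; $\mathcal{T}_p=\mathcal{T}_p^+-\mathcal{T}_p^-$. The toggleability spaces are the real vector spaces $I_T(\mathcal{P})=\mathrm{Span}_{\mathbb{R}}(\mathbf{1}_p\mid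 p\in\mathcal{P})\cap\mathrm{Span}_{\mathbb{R}}(\{1\}\cup\{\mathcal{T}_p\mid p\in\mathcal{P}\})$ and $A_T(\mathcal{P})=\mathrm{Span}_{\mathbb{R}}(\mathcal{T}_p^-\mid p\in\mathcal{P})\cap\mathrm{Span}_{\mathbb{R}}(\{1\}\cup\{\mathcal{T}_p\mid p\in\mathcal{P}\})$, where $1$ is the constant function. *)

theory Defs
  imports "HOL-Analysis.Analysis" "HOL-Library.Function_Algebras"
begin

text \<open>
  Pointwise scalar multiplication makes real-valued functions a real vector space, so that
  \<^const>\<open>span\<close> and \<^const>\<open>dim\<close> apply to sets of functions.
\<close>

instantiation "fun" :: (type, real_vector) real_vector
begin

definition scaleR_fun :: "real \<Rightarrow> ('a \<Rightarrow> 'b) \<Rightarrow> 'a \<Rightarrow> 'b" where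
  "scaleR_fun c f = (\<lambda>x. c *\<^sub>R f x)"

instance
  by standard (simp_all add: scaleR_fun_def fun_eq_iff scaleR_add_right scaleR_add_left)

end

definition integer_partition :: "nat list \<Rightarrow> bool" where
  "integer_partition lam \<longleftrightarrow> sorted_wrt (\<ge>) lam \<and> (\<forall>x \<in> set lam. 0 < x)"

text \<open>Cells are indexed from 1, list positions from 0.\<close>

definition ferrers :: "nat list \<Rightarrow> (nat \<times> nat) set" where
  "ferrers lam = {(i, j). 1 \<le> i \<and> i \<le> length lam \<and> 1 \<le> j \<and> j \<le> lam ! (i - 1)}"

definition border_strip :: "nat list \<Rightarrow> (nat \<times> nat) set" where
  "border_strip lam = {(i, j) \<in> ferrers lam. (i + 1, j + 1) \<notin> ferrers lam}"

definition corner_cells :: "nat list \<Rightarrow> (nat \<times> nat) set" where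
  "corner_cells lam =
     {(i, j) \<in> border_strip lam. (i + 1, j) \<in> border_strip lam \<and> (i, j + 1) \<in> border_strip lam}"

definition cell_le :: "nat \<times> nat \<Rightarrow> nat \<times> nat \<Rightarrow> bool" where
  "cell_le = (\<lambda>(i, j) (k, m). i \<le> k \<and> j \<le> m)"

lemma finite_ferrers: "finite (ferrers lam)"
proof -
  have "ferrers lam \<subseteq> (\<Union>i \<in> {1..length lam}. {i} \<times> {1..lam ! (i - 1)})"
    by (auto simp: ferrers_def)
  then show ?thesis
    by (rule finite_subset) auto
qed

lemma finite_border_strip: "finite (border_strip lam)"
  by (rule finite_subset[OF _ finite_ferrers[of lam]]) (auto simp: border_strip_def)

text \<open>
  A poset is given by its underlying set \<open>P\<close> and its order \<open>le\<close>.
  A real-valued function on the set of order ideals is represented by its extension by zero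
  to all sets; in particular the constant function 1 becomes the indicator of the set of
  order ideals.
\<close>

definition order_ideals :: "'a set \<Rightarrow> ('a \<Rightarrow> 'a \<Rightarrow> bool) \<Rightarrow> 'a set set" where
  "order_ideals P le = {I. I \<subseteq> P \<and> (\<forall>x \<in> I. \<forall>y \<in> P. le y x \<longrightarrow> y \<in> I)}"

definition const_one :: "'a set \<Rightarrow> ('a \<Rightarrow> 'a \<Rightarrow> bool) \<Rightarrow> 'a set \<Rightarrow> real" where
  "const_one P le = (\<lambda>I. if I \<in> order_ideals P le then 1 else 0)"

definition ideal_indicator :: "'a set \<Rightarrow> ('a \<Rightarrow> 'a \<Rightarrow> bool) \<Rightarrow> 'a \<Rightarrow> 'a set \<Rightarrow> real" where
  "ideal_indicator P le p = (\<lambda>I. if I \<in> order_ideals P le \<and> p \<in> I then 1 else 0)"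

definition toggle_minus :: "'a set \<Rightarrow> ('a \<Rightarrow> 'a \<Rightarrow> bool) \<Rightarrow> 'a \<Rightarrow> 'a set \<Rightarrow> real" where
  "toggle_minus P le p =
     (\<lambda>I. if I \<in> order_ideals P le \<and> p \<in> I \<and> (\<forall>q \<in> I. le p q \<longrightarrow> q = p) then 1 else 0)"

definition toggle_plus :: "'a set \<Rightarrow> ('a \<Rightarrow> 'a \<Rightarrow> bool) \<Rightarrow> 'a \<Rightarrow> 'a set \<Rightarrow> real" where
  "toggle_plus P le p =
     (\<lambda>I. if I \<in> order_ideals P le \<and> p \<notin> I \<and> I \<union> {p} \<in> order_ideals P le then 1 else 0)"

definition toggle :: "'a set \<Rightarrow> ('a \<Rightarrow> 'a \<Rightarrow> bool) \<Rightarrow> 'a \<Rightarrow> 'a set \<Rightarrow> real" where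
  "toggle P le p = toggle_plus P le p - toggle_minus P le p"

definition I_T :: "'a set \<Rightarrow> ('a \<Rightarrow> 'a \<Rightarrow> bool) \<Rightarrow> ('a set \<Rightarrow> real) set" where
  "I_T P le =
     span (ideal_indicator P le ` P) \<inter> span ({const_one P le} \<union> toggle P le ` P)"

definition A_T :: "'a set \<Rightarrow> ('a \<Rightarrow> 'a \<Rightarrow> bool) \<Rightarrow> ('a set \<Rightarrow> real) set" where
  "A_T P le =
     span (toggle_minus P le ` P) \<inter> span ({const_one P le} \<union> toggle P le ` P)"

end

theory Submission
  imports Defs
begin

text \<open>
  For a cell \<open>m\<close> whose lower neighbour and right neighbour both lie in the diagram (an
  inner cell), let \<open>X m\<close> be the product of the indicators of these two neighbours.
  Every \<open>T\<^sup>+\<close> and \<open>T\<^sup>-\<close> is an explicit combination of 1, the indicators \<open>1 p\<close> and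
  the functions \<open>X m\<close>, and these are linearly independent. Comparing coefficients,
  \<open>c + (\<Sum>p. a p * T p)\<close> lies in the span of the indicators iff \<open>c = - a (1, 1)\<close> and
  \<open>a (i, j) = a (i + 1, j + 1)\<close> at every inner cell, and in the span of the \<open>T\<^sup>-\<close> iff
  \<open>c = - a (1, 1)\<close> and \<open>a (i, j) = a (i + 1, j) + a (i, j + 1) - a (i + 1, j + 1)\<close> at every
  inner cell, where \<open>a = 0\<close> outside the diagram. Both systems are triangular, so a solution
  is determined by its arbitrary values at the cells that are not inner. These cells are
  the border strip without its corners.
\<close>

section \<open>Linear algebra: finite spans, injective images, coordinates\<close>

lemma sum_fun_apply: "(\<Sum>i\<in>A. f i) x = (\<Sum>i\<in>A. f i x)"
  for f :: "'i \<Rightarrow> 'a \<Rightarrow> 'b::comm_monoid_add"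
  by (induction A rule: infinite_finite_induct) auto

lemma scaleR_fun_apply: "(c *\<^sub>R f) x = c *\<^sub>R f x"
  by (simp add: scaleR_fun_def)

text \<open>The sum runs over indices because \<open>f\<close> need not be injective. Coefficients
  vanish off \<open>P\<close>, so that they can serve as points of the solution spaces
  below.\<close>

lemma span_image_finite:
  fixes f :: "'i \<Rightarrow> 'v::real_vector"
  assumes "finite P"
  shows "span (f ` P) = {\<Sum>p\<in>P. a p *\<^sub>R f p |a. \<forall>p. p \<notin> P \<longrightarrow> a p = 0}" (is "_ = ?R")
proof
  have f_eq: "f p = (\<Sum>q\<in>P. of_bool (q = p) *\<^sub>R f q)" if "p \<in> P" for p
  proof -
    have "(\<Sum>q\<in>P. of_bool (q = p) *\<^sub>R f q) = (\<Sum>q\<in>P. if q = p then f q else 0)"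
      by (rule sum.cong) auto
    then show ?thesis
      using assms that by simp
  qed
  show "span (f ` P) \<subseteq> ?R"
  proof (rule span_minimal)
    show "f ` P \<subseteq> ?R"
    proof clarify
      fix p assume "p \<in> P"
      then show "\<exists>a. f p = (\<Sum>q\<in>P. a q *\<^sub>R f q) \<and> (\<forall>q. q \<notin> P \<longrightarrow> a q = 0)"
        using f_eq by (intro exI[of _ "\<lambda>q. of_bool (q = p)"]) auto
    qed
    show "subspace ?R"
    proof (rule subspaceI)
      show "0 \<in> ?R"
        by (intro CollectI exI[of _ "\<lambda>_. 0"]) simp
    next
      fix x y assume "x \<in> ?R" "y \<in> ?R"
      then obtain a b where
        "x = (\<Sum>p\<in>P. a p *\<^sub>R f p)" "\<forall>p. p \<notin> P \<longrightarrow> a p = 0"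
        "y = (\<Sum>p\<in>P. b p *\<^sub>R f p)" "\<forall>p. p \<notin> P \<longrightarrow> b p = 0"
        by blast
      then show "x + y \<in> ?R"
        by (intro CollectI exI[of _ "\<lambda>p. a p + b p"]) (simp add: scaleR_left_distrib sum.distrib)
    next
      fix c x assume "x \<in> ?R"
      then obtain a where "x = (\<Sum>p\<in>P. a p *\<^sub>R f p)" "\<forall>p. p \<notin> P \<longrightarrow> a p = 0"
        by blast
      then show "c *\<^sub>R x \<in> ?R"
        by (intro CollectI exI[of _ "\<lambda>p. c * a p"]) (simp add: scaleR_right.sum)
    qed
  qed
  show "?R \<subseteq> span (f ` P)"
    by (auto intro!: span_sum span_scale intro: span_base)
qed

text \<open>A basis of \<open>V\<close> is carried to a basis of the image. Injectivity is asked for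
  on \<open>V\<close> alone since \<open>toggle_combination\<close>, to which this is applied, is
  not injective on all coefficient functions.\<close>

lemma dim_image_inj_on:
  fixes f :: "'u::real_vector \<Rightarrow> 'v::real_vector"
  assumes "linear f" "subspace V" "inj_on f V"
  shows "dim (f ` V) = dim V"
proof -
  obtain B where B: "B \<subseteq> V" "independent B" "V \<subseteq> span B" "card B = dim V"
    using basis_exists .
  then have "span B = V"
    using \<open>subspace V\<close> by (simp add: span_minimal subset_antisym)
  then have "independent (f ` B)" "span (f ` B) = f ` V"
    using linear_dependent_inj_imageD[OF \<open>linear f\<close>, of B] B(2)
      linear_span_image[OF \<open>linear f\<close>, of B] \<open>inj_on f V\<close> by auto
  then have "dim (f ` V) = card (f ` B)"
    using dim_span_eq_card_independent by metis
  also have "\<dots> = card B"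
    using B(1) \<open>inj_on f V\<close> by (metis card_image inj_on_subset)
  finally show ?thesis
    using B(4) by simp
qed

text \<open>Restriction to \<open>D\<close> is a bijection from \<open>V\<close> onto the functions
  on \<open>D\<close>; the preimages \<open>e q\<close> of the unit vectors form a basis of
  \<open>V\<close>.\<close>

lemma dim_eq_card_coordinates:
  fixes V :: "('a \<Rightarrow> real) set"
  assumes "subspace V" "finite D"
    and ext: "\<And>g. \<exists>a\<in>V. \<forall>p\<in>D. a p = g p"
    and zero: "\<And>a. a \<in> V \<Longrightarrow> \<forall>p\<in>D. a p = 0 \<Longrightarrow> a = 0"
  shows "dim V = card D"
proof -
  have "\<forall>q. \<exists>a\<in>V. \<forall>p\<in>D. a p = of_bool (p = q)"
    by (intro allI ext)
  then obtain e where eV: "e q \<in> V" and e: "p \<in> D \<Longrightarrow> e q p = of_bool (p = q)" for p q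
    by metis
  have coord: "(\<Sum>q\<in>D. u q *\<^sub>R e q) p = u p" if "p \<in> D" for u p
  proof -
    have "(\<Sum>q\<in>D. u q *\<^sub>R e q) p = (\<Sum>q\<in>D. if q = p then u q else 0)"
      unfolding sum_fun_apply by (rule sum.cong) (auto simp: scaleR_fun_def e that)
    then show ?thesis
      using \<open>finite D\<close> that by simp
  qed
  have inj: "inj_on e D"
    by (intro inj_onI) (metis e of_bool_eq_1_iff)
  show ?thesis
  proof (rule dim_unique)
    show "e ` D \<subseteq> V"
      using eV by blast
    show "card (e ` D) = card D"
      by (rule card_image[OF inj])
    show "independent (e ` D)"
    proof (rule independent_if_scalars_zero)
      show "finite (e ` D)"
        using \<open>finite D\<close> by simp
    next
      fix u v assume "(\<Sum>x\<in>e ` D. u x *\<^sub>R x) = 0" and "v \<in> e ` D"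
      then obtain p where p: "p \<in> D" "v = e p"
        by blast
      have "(\<Sum>q\<in>D. u (e q) *\<^sub>R e q) = 0"
        using \<open>(\<Sum>x\<in>e ` D. u x *\<^sub>R x) = 0\<close> by (simp add: sum.reindex[OF inj])
      then show "u v = 0"
        using coord[OF p(1), of "\<lambda>q. u (e q)"] p(2) by simp
    qed
    show "V \<subseteq> span (e ` D)"
    proof
      fix a assume a: "a \<in> V"
      \<comment> \<open>This difference lies in \<open>V\<close> and vanishes on \<open>D\<close>,
        so \<open>zero\<close> applies.\<close>
      have "a - (\<Sum>q\<in>D. a q *\<^sub>R e q) = 0"
      proof (rule zero)
        show "a - (\<Sum>q\<in>D. a q *\<^sub>R e q) \<in> V"
          using \<open>subspace V\<close> a eV by (intro subspace_diff subspace_sum subspace_scale)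
        show "\<forall>p\<in>D. (a - (\<Sum>q\<in>D. a q *\<^sub>R e q)) p = 0"
          by (simp add: coord)
      qed
      then have "a = (\<Sum>q\<in>D. a q *\<^sub>R e q)"
        by simp
      also have "\<dots> \<in> span (e ` D)"
        by (intro span_sum span_scale span_base) auto
      finally show "a \<in> span (e ` D)" .
    qed
  qed
qed

section \<open>Triangular systems of linear equations\<close>

text \<open>The equations are solved in order of increasing rank: \<open>L m\<close> reads only
  values of smaller rank, so a value set at the current top rank disturbs no equation.\<close>

lemma triangular_system_solvable:
  fixes L :: "'a \<Rightarrow> ('a \<Rightarrow> real) \<Rightarrow> real" and r :: "'a \<Rightarrow> int"
  assumes "finite M"
    and lower: "\<And>m a b. m \<in> M \<Longrightarrow> (\<And>p. r p < r m \<Longrightarrow> a p = b p) \<Longrightarrow> L m a = L m b"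
  shows "\<exists>a. (\<forall>p. p \<notin> M \<longrightarrow> a p = g p) \<and> (\<forall>m\<in>M. a m = L m a)"
  using assms
proof (induction M rule: finite_ranking_induct[where f = r])
  case empty
  then show ?case
    by auto
next
  case (insert x M)
  then obtain a where a: "\<And>p. p \<notin> M \<Longrightarrow> a p = g p" "\<And>m. m \<in> M \<Longrightarrow> a m = L m a"
    by (metis insertCI)
  \<comment> \<open>The induction supplies an \<open>x\<close> of maximal rank but not
    \<open>x \<notin> M\<close>; if \<open>x\<close> is already in \<open>M\<close>, its equation
    holds.\<close>
  define a' where "a' = (if x \<in> M then a else a(x := L x a))"
  have "L m a' = L m a" if "m \<in> insert x M" for m
  proof (rule insert.prems)
    show "a' p = a p" if "r p < r m" for p
      using that \<open>m \<in> insert x M\<close> insert.hyps(2)[of m] by (auto simp: a'_def)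
  qed fact
  then show ?case
    using a by (intro exI[of _ a']) (auto simp: a'_def)
qed

text \<open>At a point of minimal rank where two solutions differ, both are computed from the same
  values.\<close>

lemma triangular_system_unique:
  fixes L :: "'a \<Rightarrow> ('a \<Rightarrow> real) \<Rightarrow> real" and r :: "'a \<Rightarrow> int"
  assumes "finite M"
    and lower: "\<And>m a b. m \<in> M \<Longrightarrow> (\<And>p. r p < r m \<Longrightarrow> a p = b p) \<Longrightarrow> L m a = L m b"
    and "\<And>p. p \<notin> M \<Longrightarrow> a p = b p"
    and "\<And>m. m \<in> M \<Longrightarrow> a m = L m a" "\<And>m. m \<in> M \<Longrightarrow> b m = L m b"
  shows "a = b"
proof (rule ccontr)
  assume "a \<noteq> b"
  define S where "S = {m \<in> M. a m \<noteq> b m}"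
  define m where "m = arg_min_on r S"
  have "finite S" "S \<noteq> {}"
    using assms(1,3) \<open>a \<noteq> b\<close> by (auto simp: S_def fun_eq_iff)
  then have "m \<in> S" and min: "\<not> (\<exists>x\<in>S. r x < r m)"
    unfolding m_def by (rule arg_min_if_finite)+
  have "L m a = L m b"
  proof (rule lower)
    show "a p = b p" if "r p < r m" for p
      using min that assms(3) by (auto simp: S_def)
  qed (use \<open>m \<in> S\<close> in \<open>simp add: S_def\<close>)
  then show False
    using \<open>m \<in> S\<close> assms(4,5) by (auto simp: S_def)
qed

text \<open>The values on \<open>P - M\<close> are free coordinates: any choice extends to a
  solution, and only the zero solution vanishes on all of them.\<close>

lemma
  fixes L :: "'a \<Rightarrow> ('a \<Rightarrow> real) \<Rightarrow> real" and r :: "'a \<Rightarrow> int"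
  assumes "finite P" "M \<subseteq> P" "\<And>m. linear (L m)"
    and lower: "\<And>m a b. m \<in> M \<Longrightarrow> (\<And>p. r p < r m \<Longrightarrow> a p = b p) \<Longrightarrow> L m a = L m b"
  defines "V \<equiv> {a. (\<forall>p. p \<notin> P \<longrightarrow> a p = 0) \<and> (\<forall>m\<in>M. a m = L m a)}"
  shows subspace_triangular_system: "subspace V"
    and dim_triangular_system: "dim V = card (P - M)"
proof -
  show V: "subspace V"
    by (rule subspaceI)
      (simp_all add: V_def linear_0[OF assms(3)] linear_add[OF assms(3)]
        linear_cmul[OF assms(3)] scaleR_fun_apply)
  have "finite M"
    using assms(1,2) by (rule rev_finite_subset)
  show "dim V = card (P - M)"
  proof (rule dim_eq_card_coordinates[OF V])
    fix g :: "'a \<Rightarrow> real"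
    obtain a where "\<forall>p. p \<notin> M \<longrightarrow> a p = (if p \<in> P then g p else 0)" "\<forall>m\<in>M. a m = L m a"
      using triangular_system_solvable[where L=L and r=r, OF \<open>finite M\<close> lower, where g="\<lambda>p. if p \<in> P then g p else 0"]
      by blast
    then show "\<exists>a\<in>V. \<forall>p\<in>P - M. a p = g p"
      using \<open>M \<subseteq> P\<close> by (intro bexI[of _ a]) (auto simp: V_def)
  next
    fix a assume "a \<in> V" "\<forall>p\<in>P - M. a p = 0"
    then show "a = 0"
      by (intro triangular_system_unique[where L=L and r=r, OF \<open>finite M\<close> lower])
        (auto simp: V_def linear_0[OF assms(3)])
  qed (use assms(1) in simp)
qed

section \<open>Linear independence of 1 and the toggles\<close>

lemma finite_order_ideals: "finite P \<Longrightarrow> finite (order_ideals P le)"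
  by (rule finite_subset[of _ "Pow P"]) (auto simp: order_ideals_def)

lemma empty_in_order_ideals [simp]: "{} \<in> order_ideals P le"
  by (simp add: order_ideals_def)

text \<open>Summation by parts: \<open>I \<mapsto> I \<union> {p}\<close> is a bijection from the
  ideals to which \<open>p\<close> can be added to those in which \<open>p\<close> is
  maximal.\<close>

lemma sum_order_ideals_toggle:
  assumes "finite P" "p \<in> P"
  shows "(\<Sum>I\<in>order_ideals P le. toggle P le p I * h I) =
    (\<Sum>I | I \<in> order_ideals P le \<and> p \<notin> I \<and> I \<union> {p} \<in> order_ideals P le. h I - h (I \<union> {p}))"
    (is "_ = sum _ ?A")
proof -
  let ?J = "order_ideals P le"
  let ?B = "{I \<in> ?J. p \<in> I \<and> (\<forall>q\<in>I. le p q \<longrightarrow> q = p)}"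
  have fin: "finite ?J"
    by (rule finite_order_ideals) fact
  have "(\<Sum>I\<in>?J. toggle_plus P le p I * h I) = (\<Sum>I\<in>?A. h I)"
    by (rule sum.mono_neutral_cong_right) (auto simp: toggle_plus_def fin)
  moreover have "(\<Sum>I\<in>?J. toggle_minus P le p I * h I) = (\<Sum>I\<in>?B. h I)"
    by (rule sum.mono_neutral_cong_right) (auto simp: toggle_minus_def fin)
  moreover have "(\<Sum>I\<in>?B. h I) = (\<Sum>I\<in>?A. h (I \<union> {p}))"
  proof (rule sum.reindex_bij_witness[where i="\<lambda>I. I \<union> {p}" and j="\<lambda>I. I - {p}"])
    fix I assume I: "I \<in> ?B"
    then show "I - {p} \<in> ?A"
      by (auto simp: order_ideals_def insert_absorb)
    show "I - {p} \<union> {p} = I" "h (I - {p} \<union> {p}) = h I"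
      using I by (auto simp: insert_absorb)
  next
    fix I assume "I \<in> ?A"
    then show "I \<union> {p} \<in> ?B" "I \<union> {p} - {p} = I"
      using \<open>p \<in> P\<close> by (auto simp: order_ideals_def)
  qed
  ultimately show ?thesis
    by (simp add: toggle_def algebra_simps sum_subtractf)
qed

text \<open>
  Testing a relation \<open>c + (\<Sum>p. a p * T p) = 0\<close> against 1 gives \<open>c = 0\<close>; testing it against
  \<open>\<Sum>p. a p * 1 p\<close> then gives \<open>- (\<Sum>p. (a p)\<^sup>2 * n p) = 0\<close>, where \<open>n p > 0\<close> is the number of
  ideals to which \<open>p\<close> can be added.
\<close>

lemma toggles_independent:
  assumes "finite P" "transp le" "antisymp le"
    and zero: "c *\<^sub>R const_one P le + (\<Sum>p\<in>P. a p *\<^sub>R toggle P le p) = 0"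
    and "p \<in> P"
  shows "a p = 0"
proof -
  let ?J = "order_ideals P le"
  define A where "A p = {I \<in> ?J. p \<notin> I \<and> I \<union> {p} \<in> ?J}" for p
  define h where "h I = (\<Sum>p\<in>P. if p \<in> I then a p else 0)" for I
  have fin: "finite ?J" "finite (A p)" for p
    using finite_order_ideals[OF \<open>finite P\<close>] by (auto simp: A_def)
  have rel: "c + (\<Sum>p\<in>P. a p * toggle P le p I) = 0" if "I \<in> ?J" for I
    using fun_cong[OF zero, of I] that
    by (simp add: scaleR_fun_apply sum_fun_apply const_one_def)
  have test: "(\<Sum>I\<in>?J. c * g I) + (\<Sum>p\<in>P. a p * (\<Sum>I\<in>A p. g I - g (I \<union> {p}))) = 0" for g
  proof -
    have "0 = (\<Sum>I\<in>?J. (c + (\<Sum>p\<in>P. a p * toggle P le p I)) * g I)"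
      by (simp add: rel)
    also have "\<dots> = (\<Sum>I\<in>?J. c * g I) + (\<Sum>I\<in>?J. \<Sum>p\<in>P. a p * (toggle P le p I * g I))"
      by (simp add: distrib_right sum.distrib sum_distrib_right mult.assoc)
    also have "(\<Sum>I\<in>?J. \<Sum>p\<in>P. a p * (toggle P le p I * g I)) =
        (\<Sum>p\<in>P. a p * (\<Sum>I\<in>?J. toggle P le p I * g I))"
      by (subst sum.swap) (simp add: sum_distrib_left)
    also have "\<dots> = (\<Sum>p\<in>P. a p * (\<Sum>I\<in>A p. g I - g (I \<union> {p})))"
      using sum_order_ideals_toggle[OF \<open>finite P\<close>] by (simp add: A_def)
    finally show ?thesis
      by simp
  qed
  have "?J \<noteq> {}"
    using empty_in_order_ideals by blast
  then have "c = 0"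
    using test[of "\<lambda>_. 1"] fin by auto
  have "h I - h (I \<union> {p}) = - a p" if "I \<in> A p" "p \<in> P" for I p
  proof -
    have "h (I \<union> {p}) - h I = (\<Sum>q\<in>P. if q = p then a q else 0)"
      unfolding h_def sum_subtractf[symmetric] using that by (intro sum.cong) (auto simp: A_def)
    then show ?thesis
      using \<open>finite P\<close> \<open>p \<in> P\<close> by simp
  qed
  then have "(\<Sum>p\<in>P. (a p)\<^sup>2 * card (A p)) = 0"
    using test[of h] \<open>c = 0\<close> by (simp add: power2_eq_square sum_negf mult_ac)
  then have "(a p)\<^sup>2 * card (A p) = 0"
    using \<open>p \<in> P\<close> \<open>finite P\<close> by (subst (asm) sum_nonneg_eq_0_iff) auto
  \<comment> \<open>The elements strictly below \<open>p\<close> form an ideal to which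
    \<open>p\<close> can be added, so \<open>A p\<close> is nonempty.\<close>
  moreover have "{q \<in> P. le q p \<and> q \<noteq> p} \<in> A p"
    using \<open>p \<in> P\<close> \<open>transp le\<close> \<open>antisymp le\<close>
    by (auto simp: A_def order_ideals_def dest: transpD antisympD)
  ultimately show ?thesis
    using fin by auto
qed

section \<open>Young diagrams, with toggles expanded in indicators and their products\<close>

lemma transp_cell_le: "transp cell_le"
  by (auto simp: transp_def cell_le_def)

lemma antisymp_cell_le: "antisymp cell_le"
  by (auto simp: antisymp_def cell_le_def)

text \<open>A Ferrers diagram seen as a finite down-closed set in the positive quadrant.\<close>

locale young_diagram =
  fixes P :: "(nat \<times> nat) set"
  assumes finite_P: "finite P"
    and pos: "(i, j) \<in> P \<Longrightarrow> 1 \<le> i \<and> 1 \<le> j"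
    and down: "(i, j) \<in> P \<Longrightarrow> 1 \<le> i' \<Longrightarrow> i' \<le> i \<Longrightarrow> 1 \<le> j' \<Longrightarrow> j' \<le> j \<Longrightarrow> (i', j') \<in> P"
begin

abbreviation ideals :: "(nat \<times> nat) set set" where
  "ideals \<equiv> order_ideals P cell_le"

text \<open>The diagonal neighbour \<open>(i + 1, j + 1)\<close> may lie outside \<open>P\<close>;
  the inner cells for which it does are the corner cells.\<close>

definition inner :: "(nat \<times> nat) set" where
  "inner = {(i, j) \<in> P. (i + 1, j) \<in> P \<and> (i, j + 1) \<in> P}"

lemma finite_inner: "finite inner"
  by (rule finite_subset[OF _ finite_P]) (auto simp: inner_def)

lemma zero_notin [simp]: "(0, j) \<notin> P" "(i, 0) \<notin> P"
  using pos by fastforce+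

lemma pred_in:
  assumes "(i, j) \<in> P"
  shows "i \<noteq> Suc 0 \<Longrightarrow> Suc (i - Suc 0) = i \<and> (i - Suc 0, j) \<in> P"
    and "j \<noteq> Suc 0 \<Longrightarrow> Suc (j - Suc 0) = j \<and> (i, j - Suc 0) \<in> P"
  using pos[OF assms] down[OF assms, of "i - 1" j] down[OF assms, of i "j - 1"] by auto

lemma ideal_subset: "I \<in> ideals \<Longrightarrow> p \<in> I \<Longrightarrow> p \<in> P"
  by (auto simp: order_ideals_def)

lemma ideal_down:
  assumes "I \<in> ideals" "(i, j) \<in> I" "1 \<le> i'" "i' \<le> i" "1 \<le> j'" "j' \<le> j"
  shows "(i', j') \<in> I"
  using assms down[of i j i' j'] by (fastforce simp: order_ideals_def cell_le_def)

lemma ideal_zero_notin: "I \<in> ideals \<Longrightarrow> (0, j) \<notin> I" "I \<in> ideals \<Longrightarrow> (i, 0) \<notin> I"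
  using ideal_subset zero_notin by blast+

lemma ideal_indicator_eq: "I \<in> ideals \<Longrightarrow> ideal_indicator P cell_le p I = of_bool (p \<in> I)"
  by (simp add: ideal_indicator_def)

text \<open>Inclusion-exclusion: maximality of a cell of \<open>I\<close> means that neither the
  lower nor the right neighbour is in \<open>I\<close>, and each neighbour in \<open>I\<close>
  forces the cell itself into \<open>I\<close>.\<close>

lemma toggle_minus_eq:
  assumes I: "I \<in> ideals" and "(i, j) \<in> P"
  shows "toggle_minus P cell_le (i, j) I = of_bool ((i, j) \<in> I) - of_bool ((i + 1, j) \<in> I)
    - of_bool ((i, j + 1) \<in> I) + of_bool ((i + 1, j) \<in> I \<and> (i, j + 1) \<in> I)"
proof -
  have ij: "1 \<le> i" "1 \<le> j"
    using pos[OF assms(2)] by auto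
  have imp: "(i + 1, j) \<in> I \<Longrightarrow> (i, j) \<in> I" "(i, j + 1) \<in> I \<Longrightarrow> (i, j) \<in> I"
    using ideal_down[OF I] ij by auto
  have "(\<forall>q\<in>I. cell_le (i, j) q \<longrightarrow> q = (i, j)) \<longleftrightarrow> (i + 1, j) \<notin> I \<and> (i, j + 1) \<notin> I"
  proof (intro iffI conjI ballI impI)
    fix q assume *: "(i + 1, j) \<notin> I \<and> (i, j + 1) \<notin> I" "q \<in> I" "cell_le (i, j) q"
    obtain k l where q: "q = (k, l)"
      by fastforce
    with * have "i \<le> k" "j \<le> l"
      by (auto simp: cell_le_def)
    moreover have "\<not> i + 1 \<le> k" "\<not> j + 1 \<le> l"
      using * q ideal_down[OF I, of k l "i + 1" j] ideal_down[OF I, of k l i "j + 1"] ij calculation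
      by auto
    ultimately show "q = (i, j)"
      using q by simp
  qed (auto simp: cell_le_def)
  then show ?thesis
    using I imp by (auto simp: toggle_minus_def)
qed

text \<open>A cell is in \<open>I\<close> or can be added to it exactly when its upper and left
  neighbours, where they exist, are in \<open>I\<close>; the case that it is already in
  \<open>I\<close> is subtracted.\<close>

lemma toggle_plus_eq:
  assumes I: "I \<in> ideals" and "(i, j) \<in> P"
  shows "toggle_plus P cell_le (i, j) I =
    of_bool ((i = 1 \<or> (i - 1, j) \<in> I) \<and> (j = 1 \<or> (i, j - 1) \<in> I)) - of_bool ((i, j) \<in> I)"
proof -
  have ij: "1 \<le> i" "1 \<le> j"
    using pos[OF assms(2)] by auto
  have imp: "(i, j) \<in> I \<Longrightarrow> (i = 1 \<or> (i - 1, j) \<in> I) \<and> (j = 1 \<or> (i, j - 1) \<in> I)"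
    using ideal_down[OF I, of i j "i - 1" j] ideal_down[OF I, of i j i "j - 1"] ij
    by (cases i; cases j) (auto simp: Suc_le_eq)
  have "I \<union> {(i, j)} \<in> ideals \<longleftrightarrow> (i = 1 \<or> (i - 1, j) \<in> I) \<and> (j = 1 \<or> (i, j - 1) \<in> I)"
  proof
    assume K: "I \<union> {(i, j)} \<in> ideals"
    show "(i = 1 \<or> (i - 1, j) \<in> I) \<and> (j = 1 \<or> (i, j - 1) \<in> I)"
      using ideal_down[OF K, of i j "i - 1" j] ideal_down[OF K, of i j i "j - 1"] ij
      by (cases i; cases j) (auto simp: Suc_le_eq)
  next
    assume *: "(i = 1 \<or> (i - 1, j) \<in> I) \<and> (j = 1 \<or> (i, j - 1) \<in> I)"
    have "(k, l) \<in> I \<union> {(i, j)}" if "(k, l) \<in> P" "k \<le> i" "l \<le> j" for k l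
    proof -
      \<comment> \<open>A cell strictly below \<open>(i, j)\<close> is below its upper or its left
        neighbour. If that neighbour is missing, positivity of \<open>k\<close> and \<open>l\<close>
        rules out the alternative.\<close>
      have "(k, l) = (i, j) \<or> k \<le> i - 1 \<or> l \<le> j - 1"
        using that by auto
      then show ?thesis
        using * ideal_down[OF I, of "i - 1" j k l] ideal_down[OF I, of i "j - 1" k l]
          pos[OF that(1)] that ij by auto
    qed
    then show "I \<union> {(i, j)} \<in> ideals"
      using I \<open>(i, j) \<in> P\<close> by (auto simp: order_ideals_def cell_le_def)
  qed
  then show ?thesis
    using I imp by (auto simp: toggle_plus_def)
qed

text \<open>The coefficient of the indicator of \<open>(i, j)\<close> in a combination with
  coefficients \<open>a\<close> of \<open>T\<^sup>+\<close>, \<open>b\<close> of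
  \<open>T\<^sup>-\<close> and \<open>d\<close> of the indicators. The two conditional terms come
  from cells in the first row or column, whose \<open>T\<^sup>+\<close> tests a single neighbour.
  Index 0 falls outside the diagram, where \<open>b\<close> will be 0.\<close>

definition linear_coeff ::
  "(nat \<times> nat \<Rightarrow> real) \<Rightarrow> (nat \<times> nat \<Rightarrow> real) \<Rightarrow> (nat \<times> nat \<Rightarrow> real) \<Rightarrow> nat \<times> nat \<Rightarrow> real" where
  "linear_coeff a b d = (\<lambda>(i, j). d (i, j) + b (i, j) - a (i, j) - b (i - 1, j) - b (i, j - 1)
     + (if i = 1 then a (i, j + 1) else 0) + (if j = 1 then a (i + 1, j) else 0))"

text \<open>Both \<open>T\<^sup>-\<close> at \<open>(i, j)\<close> and \<open>T\<^sup>+\<close> at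
  \<open>(i + 1, j + 1)\<close> contain the product \<open>X (i, j)\<close>, and
  \<open>T\<^sup>+\<close> at \<open>(1, 1)\<close> contains the constant 1.\<close>

lemma toggle_expansion:
  assumes I: "I \<in> ideals" and a: "\<And>p. p \<notin> P \<Longrightarrow> a p = 0" and b: "\<And>p. p \<notin> P \<Longrightarrow> b p = 0"
  shows "c + (\<Sum>p\<in>P. a p * toggle_plus P cell_le p I) + (\<Sum>p\<in>P. b p * toggle_minus P cell_le p I)
      + (\<Sum>p\<in>P. d p * ideal_indicator P cell_le p I) =
    c + a (1, 1)
      + (\<Sum>(i, j)\<in>inner. (a (i + 1, j + 1) + b (i, j)) * of_bool ((i + 1, j) \<in> I \<and> (i, j + 1) \<in> I))
      + (\<Sum>p\<in>P. linear_coeff a b d p * of_bool (p \<in> I))"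
proof -
  define e :: "nat \<times> nat \<Rightarrow> real" where "e p = of_bool (p \<in> I)" for p
  define x :: "nat \<times> nat \<Rightarrow> real" where
    "x = (\<lambda>(i, j). of_bool ((i + 1, j) \<in> I \<and> (i, j + 1) \<in> I))"
  have eP: "e p = 0" if "p \<notin> P" for p
    using that ideal_subset[OF I, of p] by (auto simp: e_def)
  have xP: "x p = 0" if "p \<notin> inner" for p
  proof -
    have "x p = 0" if "x p \<noteq> 0"
      using that \<open>p \<notin> inner\<close> ideal_subset[OF I] down[of "fst p + 1" "snd p" "fst p" "snd p"]
        ideal_zero_notin[OF I]
      by (cases p; cases "fst p"; cases "snd p") (auto simp: x_def inner_def split: if_splits)
    then show ?thesis
      by blast
  qed

  have minus: "(\<Sum>p\<in>P. b p * toggle_minus P cell_le p I) =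
      (\<Sum>(i, j)\<in>P. b (i, j) * e (i, j)) - (\<Sum>(i, j)\<in>P. b (i, j) * e (i + 1, j))
      - (\<Sum>(i, j)\<in>P. b (i, j) * e (i, j + 1)) + (\<Sum>(i, j)\<in>P. b (i, j) * x (i, j))"
    unfolding sum_subtractf[symmetric] sum.distrib[symmetric]
    by (rule sum.cong) (auto simp: toggle_minus_eq[OF I] e_def x_def algebra_simps)
  \<comment> \<open>The four shapes of \<open>T\<^sup>+\<close>: the cell \<open>(1, 1)\<close>, the
    rest of the first row, the rest of the first column, and all other cells.\<close>
  have plus: "(\<Sum>p\<in>P. a p * toggle_plus P cell_le p I) =
      (\<Sum>p\<in>P. if p = (1, 1) then a p else 0)
      + (\<Sum>(i, j)\<in>P. if i = 1 \<and> j > 1 then a (i, j) * e (i, j - 1) else 0)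
      + (\<Sum>(i, j)\<in>P. if j = 1 \<and> i > 1 then a (i, j) * e (i - 1, j) else 0)
      + (\<Sum>(i, j)\<in>P. if i > 1 \<and> j > 1 then a (i, j) * x (i - 1, j - 1) else 0)
      - (\<Sum>(i, j)\<in>P. a (i, j) * e (i, j))"
    unfolding sum_subtractf[symmetric] sum.distrib[symmetric]
  proof (rule sum.cong)
    fix p assume "p \<in> P"
    moreover obtain i j where p: "p = (i, j)"
      by fastforce
    ultimately have ij: "(i, j) \<in> P" "1 \<le> i" "1 \<le> j"
      using pos by blast+
    consider "i = 1" "j = 1" | "i = 1" "1 < j" | "1 < i" "j = 1" | "1 < i" "1 < j"
      using ij by linarith
    then show "a p * toggle_plus P cell_le p I =
        (if p = (1, 1) then a p else 0)
        + (case p of (i, j) \<Rightarrow> if i = 1 \<and> j > 1 then a (i, j) * e (i, j - 1) else 0)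
        + (case p of (i, j) \<Rightarrow> if j = 1 \<and> i > 1 then a (i, j) * e (i - 1, j) else 0)
        + (case p of (i, j) \<Rightarrow> if i > 1 \<and> j > 1 then a (i, j) * x (i - 1, j - 1) else 0)
        - (case p of (i, j) \<Rightarrow> a (i, j) * e (i, j))"
      unfolding p toggle_plus_eq[OF I ij(1)]
      by cases (simp_all add: e_def x_def right_diff_distrib conj_commute)
  qed simp

  \<comment> \<open>In \<open>r1\<close> to \<open>r5\<close> the index is shifted so that
    \<open>e\<close> or \<open>x\<close> is evaluated at the summation cell. The sets
    \<open>S'\<close> and \<open>T'\<close> collect the unmatched terms, which are all 0.\<close>
  have r1: "(\<Sum>(i, j)\<in>P. b (i, j) * e (i + 1, j)) = (\<Sum>(i, j)\<in>P. b (i - 1, j) * e (i, j))"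
    by (rule sum.reindex_bij_witness_not_neutral
        [where j = "\<lambda>(i, j). (i + 1, j)" and i = "\<lambda>(i, j). (i - 1, j)"
          and S' = "{(i, j) \<in> P. (i + 1, j) \<notin> P}" and T' = "{(i, j) \<in> P. i = 1}"])
      (auto intro: finite_subset[OF _ finite_P] simp: eP b pred_in)
  have r2: "(\<Sum>(i, j)\<in>P. b (i, j) * e (i, j + 1)) = (\<Sum>(i, j)\<in>P. b (i, j - 1) * e (i, j))"
    by (rule sum.reindex_bij_witness_not_neutral
        [where j = "\<lambda>(i, j). (i, j + 1)" and i = "\<lambda>(i, j). (i, j - 1)"
          and S' = "{(i, j) \<in> P. (i, j + 1) \<notin> P}" and T' = "{(i, j) \<in> P. j = 1}"])
      (auto intro: finite_subset[OF _ finite_P] simp: eP b pred_in)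
  have r3: "(\<Sum>(i, j)\<in>P. if i = 1 \<and> j > 1 then a (i, j) * e (i, j - 1) else 0) =
      (\<Sum>(i, j)\<in>P. (if i = 1 then a (i, j + 1) else 0) * e (i, j))"
    by (rule sum.reindex_bij_witness_not_neutral
        [where j = "\<lambda>(i, j). (i, j - 1)" and i = "\<lambda>(i, j). (i, j + 1)"
          and S' = "{(i, j) \<in> P. \<not> (i = 1 \<and> j > 1)}"
          and T' = "{(i, j) \<in> P. \<not> (i = 1 \<and> (i, j + 1) \<in> P)}"])
      (auto intro: finite_subset[OF _ finite_P] dest: pos simp: a eP pred_in)
  have r4: "(\<Sum>(i, j)\<in>P. if j = 1 \<and> i > 1 then a (i, j) * e (i - 1, j) else 0) =
      (\<Sum>(i, j)\<in>P. (if j = 1 then a (i + 1, j) else 0) * e (i, j))"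
    by (rule sum.reindex_bij_witness_not_neutral
        [where j = "\<lambda>(i, j). (i - 1, j)" and i = "\<lambda>(i, j). (i + 1, j)"
          and S' = "{(i, j) \<in> P. \<not> (j = 1 \<and> i > 1)}"
          and T' = "{(i, j) \<in> P. \<not> (j = 1 \<and> (i + 1, j) \<in> P)}"])
      (auto intro: finite_subset[OF _ finite_P] dest: pos simp: a eP pred_in)
  have r5: "(\<Sum>(i, j)\<in>P. if i > 1 \<and> j > 1 then a (i, j) * x (i - 1, j - 1) else 0) =
      (\<Sum>(i, j)\<in>inner. a (i + 1, j + 1) * x (i, j))"
    by (rule sum.reindex_bij_witness_not_neutral
        [where j = "\<lambda>(i, j). (i - 1, j - 1)" and i = "\<lambda>(i, j). (i + 1, j + 1)"
          and S' = "{(i, j) \<in> P. \<not> (i > 1 \<and> j > 1)}"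
          and T' = "{(i, j) \<in> inner. (i + 1, j + 1) \<notin> P}"])
      (auto intro: finite_subset[OF _ finite_P] dest: pos simp: a xP inner_def pred_in)
  have r6: "(\<Sum>(i, j)\<in>P. b (i, j) * x (i, j)) = (\<Sum>(i, j)\<in>inner. b (i, j) * x (i, j))"
    by (rule sum.mono_neutral_right) (use finite_P xP in \<open>auto simp: inner_def\<close>)
  have r7: "(\<Sum>p\<in>P. if p = (1, 1) then a p else 0) = a (1, 1)"
    using a finite_P by (cases "(1, 1) \<in> P") auto
  have "(\<Sum>p\<in>P. linear_coeff a b d p * e p) =
      (\<Sum>p\<in>P. d p * e p) + (\<Sum>(i, j)\<in>P. b (i, j) * e (i, j)) - (\<Sum>(i, j)\<in>P. a (i, j) * e (i, j))
      - (\<Sum>(i, j)\<in>P. b (i - 1, j) * e (i, j)) - (\<Sum>(i, j)\<in>P. b (i, j - 1) * e (i, j))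
      + (\<Sum>(i, j)\<in>P. (if i = 1 then a (i, j + 1) else 0) * e (i, j))
      + (\<Sum>(i, j)\<in>P. (if j = 1 then a (i + 1, j) else 0) * e (i, j))"
    unfolding sum_subtractf[symmetric] sum.distrib[symmetric]
    by (rule sum.cong) (auto simp: linear_coeff_def algebra_simps)
  moreover have "(\<Sum>(i, j)\<in>inner. (a (i + 1, j + 1) + b (i, j)) * x (i, j)) =
      (\<Sum>(i, j)\<in>inner. a (i + 1, j + 1) * x (i, j)) + (\<Sum>(i, j)\<in>inner. b (i, j) * x (i, j))"
    unfolding sum.distrib[symmetric] by (rule sum.cong) (auto simp: algebra_simps)
  moreover have "(\<Sum>p\<in>P. d p * ideal_indicator P cell_le p I) = (\<Sum>p\<in>P. d p * e p)"
    by (simp add: ideal_indicator_eq[OF I] e_def)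
  ultimately have "c + (\<Sum>p\<in>P. a p * toggle_plus P cell_le p I)
      + (\<Sum>p\<in>P. b p * toggle_minus P cell_le p I) + (\<Sum>p\<in>P. d p * ideal_indicator P cell_le p I) =
    c + a (1, 1) + (\<Sum>(i, j)\<in>inner. (a (i + 1, j + 1) + b (i, j)) * x (i, j))
      + (\<Sum>p\<in>P. linear_coeff a b d p * e p)"
    unfolding minus plus r1 r2 r3 r4 r5 r6 r7 by linarith
  then show ?thesis
    by (simp add: e_def x_def cong: sum.cong prod.case_cong)
qed

section \<open>Comparison of coefficients\<close>

text \<open>The empty ideal isolates \<open>c\<close>, a mixed second difference isolates each
  \<open>v m\<close>, and then a first difference isolates each \<open>u p\<close>.\<close>

lemma expansion_unique:
  assumes zero: "\<And>I. I \<in> ideals \<Longrightarrow> c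
      + (\<Sum>(i, j)\<in>inner. v (i, j) * of_bool ((i + 1, j) \<in> I \<and> (i, j + 1) \<in> I))
      + (\<Sum>p\<in>P. u p * of_bool (p \<in> I)) = (0 :: real)"
  shows "c = 0" "m \<in> inner \<Longrightarrow> v m = 0" "p \<in> P \<Longrightarrow> u p = 0"
proof -
  show "c = 0"
    using zero[of "{}"] by simp
  have v: "v (i, j) = 0" if "(i, j) \<in> inner" for i j
  proof -
    let ?x = "(i + 1, j)" and ?y = "(i, j + 1)"
    \<comment> \<open>The ideal generated by the two neighbours. Both are maximal in it, so they can
      be removed independently.\<close>
    define K where "K = {q \<in> P. cell_le q ?x \<or> cell_le q ?y}"
    define w :: "(nat \<times> nat) set \<Rightarrow> nat \<times> nat \<Rightarrow> real" where
      "w I = (\<lambda>(i, j). of_bool ((i + 1, j) \<in> I \<and> (i, j + 1) \<in> I))" for I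
    have xy: "?x \<in> P" "?y \<in> P"
      using that by (auto simp: inner_def)
    then have K: "?x \<in> K" "?y \<in> K"
      by (auto simp: K_def cell_le_def)
    have ideals: "K \<in> ideals" "K - {?x} \<in> ideals" "K - {?y} \<in> ideals" "K - {?x, ?y} \<in> ideals"
      by (auto simp: K_def order_ideals_def cell_le_def)
    have F: "c + (\<Sum>m\<in>inner. v m * w I m) + (\<Sum>p\<in>P. u p * of_bool (p \<in> I)) = 0"
      if "I \<in> ideals" for I
      using zero[OF that] by (simp add: w_def case_prod_unfold)
    \<comment> \<open>The mixed difference kills constants and linear terms. A product survives only
      if its two factors are \<open>?x\<close> and \<open>?y\<close>, that is, for
      \<open>m = (i, j)\<close>.\<close>
    have "(\<Sum>p\<in>P. u p * of_bool (p \<in> K)) - (\<Sum>p\<in>P. u p * of_bool (p \<in> K - {?x}))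
        - (\<Sum>p\<in>P. u p * of_bool (p \<in> K - {?y})) + (\<Sum>p\<in>P. u p * of_bool (p \<in> K - {?x, ?y})) = 0"
      unfolding sum_subtractf[symmetric] sum.distrib[symmetric]
      by (rule sum.neutral) auto
    moreover have "(\<Sum>m\<in>inner. v m * w K m) - (\<Sum>m\<in>inner. v m * w (K - {?x}) m)
        - (\<Sum>m\<in>inner. v m * w (K - {?y}) m) + (\<Sum>m\<in>inner. v m * w (K - {?x, ?y}) m) =
      (\<Sum>m\<in>inner. if m = (i, j) then v m else 0)"
      unfolding sum_subtractf[symmetric] sum.distrib[symmetric]
      using K by (intro sum.cong) (auto simp: w_def of_bool_def split: if_splits)
    ultimately have "(\<Sum>m\<in>inner. if m = (i, j) then v m else 0) = 0"
      using ideals[THEN F] by linarith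
    then show ?thesis
      using finite_inner that by simp
  qed
  then show "v m = 0" if "m \<in> inner" for m
    using that by (cases m) simp
  have u: "(\<Sum>p\<in>P. u p * of_bool (p \<in> I)) = 0" if "I \<in> ideals" for I
  proof -
    have "(\<Sum>(i, j)\<in>inner. v (i, j) * of_bool ((i + 1, j) \<in> I \<and> (i, j + 1) \<in> I)) = 0"
      by (rule sum.neutral) (auto simp: v)
    then show ?thesis
      using zero[OF that] \<open>c = 0\<close> by simp
  qed
  show "u p = 0" if "p \<in> P" for p
  proof -
    \<comment> \<open>Passing from the principal ideal of \<open>p\<close> to the same ideal without
      \<open>p\<close> changes only the indicator of \<open>p\<close>.\<close>
    define K where "K = {q \<in> P. cell_le q p}"
    have "K \<in> ideals" "K - {p} \<in> ideals"
      by (auto simp: K_def order_ideals_def cell_le_def)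
    then have "(\<Sum>q\<in>P. u q * of_bool (q \<in> K)) - (\<Sum>q\<in>P. u q * of_bool (q \<in> K - {p})) = 0"
      by (simp add: u del: Diff_iff)
    moreover have "(\<Sum>q\<in>P. u q * of_bool (q \<in> K)) - (\<Sum>q\<in>P. u q * of_bool (q \<in> K - {p})) =
        (\<Sum>q\<in>P. if q = p then u q else 0)"
      unfolding sum_subtractf[symmetric]
      by (rule sum.cong) (auto simp: K_def cell_le_def)
    ultimately show ?thesis
      using finite_P that by simp
  qed
qed

lemma combination_eq_0_iff:
  assumes a: "\<And>p. p \<notin> P \<Longrightarrow> a p = 0" and b: "\<And>p. p \<notin> P \<Longrightarrow> b p = 0"
  shows "c *\<^sub>R const_one P cell_le + (\<Sum>p\<in>P. a p *\<^sub>R toggle_plus P cell_le p)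
      + (\<Sum>p\<in>P. b p *\<^sub>R toggle_minus P cell_le p)
      + (\<Sum>p\<in>P. d p *\<^sub>R ideal_indicator P cell_le p) = 0 \<longleftrightarrow>
    c + a (1, 1) = 0 \<and> (\<forall>(i, j)\<in>inner. a (i + 1, j + 1) + b (i, j) = 0) \<and>
    (\<forall>p\<in>P. linear_coeff a b d p = 0)"
    (is "?f = 0 \<longleftrightarrow> ?R")
proof -
  define v where "v = (\<lambda>(i, j). a (i + 1, j + 1) + b (i, j))"
  define f where "f = ?f"
  have f: "f I = (c + a (1, 1))
      + (\<Sum>(i, j)\<in>inner. v (i, j) * of_bool ((i + 1, j) \<in> I \<and> (i, j + 1) \<in> I))
      + (\<Sum>p\<in>P. linear_coeff a b d p * of_bool (p \<in> I))" if "I \<in> ideals" for I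
  proof -
    have "f I = c + (\<Sum>p\<in>P. a p * toggle_plus P cell_le p I)
        + (\<Sum>p\<in>P. b p * toggle_minus P cell_le p I)
        + (\<Sum>p\<in>P. d p * ideal_indicator P cell_le p I)"
      using that by (simp add: f_def scaleR_fun_apply sum_fun_apply const_one_def)
    then show ?thesis
      unfolding v_def prod.case by (rule trans[OF _ toggle_expansion[OF that a b]])
  qed
  \<comment> \<open>All functions are extended by zero, so equality of functions need only be tested
    on ideals.\<close>
  have f0: "f I = 0" if "I \<notin> ideals" for I
    using that by (simp add: f_def scaleR_fun_apply sum_fun_apply const_one_def toggle_plus_def
        toggle_minus_def ideal_indicator_def)
  have "f = 0 \<longleftrightarrow> c + a (1, 1) = 0 \<and> (\<forall>m\<in>inner. v m = 0) \<and> (\<forall>p\<in>P. linear_coeff a b d p = 0)"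
    (is "_ \<longleftrightarrow> ?Q")
  proof
    assume "f = 0"
    then have "(c + a (1, 1))
      + (\<Sum>(i, j)\<in>inner. v (i, j) * of_bool ((i + 1, j) \<in> I \<and> (i, j + 1) \<in> I))
      + (\<Sum>p\<in>P. linear_coeff a b d p * of_bool (p \<in> I)) = 0" if "I \<in> ideals" for I
      using f[OF that] by simp
    from expansion_unique[OF this] show ?Q
      by blast
  next
    assume Q: ?Q
    have "f I = 0" if "I \<in> ideals" for I
    proof -
      have "(\<Sum>(i, j)\<in>inner. v (i, j) * of_bool ((i + 1, j) \<in> I \<and> (i, j + 1) \<in> I)) = 0"
        by (rule sum.neutral) (use Q in auto)
      moreover have "(\<Sum>p\<in>P. linear_coeff a b d p * of_bool (p \<in> I)) = 0"
        by (rule sum.neutral) (use Q in auto)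
      ultimately show ?thesis
        unfolding f[OF that] using Q by linarith
    qed
    with f0 show "f = 0"
      by (auto simp: fun_eq_iff)
  qed
  also have "(\<forall>m\<in>inner. v m = 0) \<longleftrightarrow> (\<forall>(i, j)\<in>inner. a (i + 1, j + 1) + b (i, j) = 0)"
    unfolding v_def by (rule ball_cong) auto
  finally show ?thesis
    unfolding f_def .
qed

section \<open>The two toggleability spaces as images of solution spaces\<close>

text \<open>The constant \<open>- a (1, 1)\<close> is forced in both spaces: indicators and
  \<open>T\<^sup>-\<close> vanish on the empty ideal.\<close>

definition toggle_combination :: "(nat \<times> nat \<Rightarrow> real) \<Rightarrow> (nat \<times> nat) set \<Rightarrow> real" where
  "toggle_combination a =
     (\<Sum>p\<in>P. a p *\<^sub>R toggle P cell_le p) - a (1, 1) *\<^sub>R const_one P cell_le"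

lemma linear_toggle_combination: "linear toggle_combination"
  by (rule linearI)
    (simp_all add: toggle_combination_def scaleR_fun_apply scaleR_left_distrib sum.distrib
      scaleR_right.sum scaleR_right_diff_distrib)

text \<open>Two coefficient functions with the same image differ by a relation among 1 and the
  toggles, hence agree on \<open>P\<close>; off \<open>P\<close> both are 0.\<close>

lemma inj_on_toggle_combination:
  assumes "subspace V" and V: "\<And>a p. a \<in> V \<Longrightarrow> p \<notin> P \<Longrightarrow> a p = 0"
  shows "inj_on toggle_combination V"
proof (rule inj_onI)
  fix a b assume ab: "a \<in> V" "b \<in> V" "toggle_combination a = toggle_combination b"
  then have "toggle_combination (a - b) = 0"
    by (simp add: linear_diff[OF linear_toggle_combination])
  then have zero: "(- (a - b) (1, 1)) *\<^sub>R const_one P cell_le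
      + (\<Sum>p\<in>P. (a - b) p *\<^sub>R toggle P cell_le p) = 0"
    unfolding toggle_combination_def by (simp only: scaleR_minus_left) (simp only: add.commute diff_conv_add_uminus)
  have "(a - b) p = 0" for p
    using toggles_independent[OF finite_P transp_cell_le antisymp_cell_le zero, of p] V[OF ab(1), of p] V[OF ab(2), of p]
    by (cases "p \<in> P") auto
  then show "a = b"
    by (auto simp: fun_eq_iff)
qed

lemma toggle_combination_in_span:
  "toggle_combination a \<in> span ({const_one P cell_le} \<union> toggle P cell_le ` P)"
  unfolding toggle_combination_def
  by (intro span_diff span_sum span_scale span_base) auto

lemma const_toggle_spanE:
  assumes "f \<in> span ({const_one P cell_le} \<union> toggle P cell_le ` P)"
  obtains a c where "\<forall>p. p \<notin> P \<longrightarrow> a p = 0"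
    "f = c *\<^sub>R const_one P cell_le + (\<Sum>p\<in>P. a p *\<^sub>R toggle P cell_le p)"
proof -
  obtain c where "f - c *\<^sub>R const_one P cell_le \<in> span (toggle P cell_le ` P)"
    using assms by (auto simp: span_insert)
  then obtain a where "\<forall>p. p \<notin> P \<longrightarrow> a p = 0"
    "f - c *\<^sub>R const_one P cell_le = (\<Sum>p\<in>P. a p *\<^sub>R toggle P cell_le p)"
    by (auto simp: span_image_finite[OF finite_P])
  then show ?thesis
    by (intro that[of a c]) (auto simp: algebra_simps)
qed

lemma sum_scaleR_toggle:
  "(\<Sum>p\<in>P. a p *\<^sub>R toggle P le p) =
    (\<Sum>p\<in>P. a p *\<^sub>R toggle_plus P le p) - (\<Sum>p\<in>P. a p *\<^sub>R toggle_minus P le p)"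
  by (simp add: toggle_def scaleR_right_diff_distrib sum_subtractf)

text \<open>Functions constant along each diagonal of the diagram, and 0 on a diagonal that ends in
  a corner cell.\<close>

definition diagonal_solutions :: "(nat \<times> nat \<Rightarrow> real) set" where
  "diagonal_solutions = {a. (\<forall>p. p \<notin> P \<longrightarrow> a p = 0) \<and>
     (\<forall>m\<in>inner. a m = (case m of (i, j) \<Rightarrow> a (i + 1, j + 1)))}"

text \<open>The alternating sum over the two-by-two square starting at an inner cell is 0, where the
  fourth cell counts as 0 if it is outside.\<close>

definition square_solutions :: "(nat \<times> nat \<Rightarrow> real) set" where
  "square_solutions = {a. (\<forall>p. p \<notin> P \<longrightarrow> a p = 0) \<and>
     (\<forall>m\<in>inner. a m = (case m of (i, j) \<Rightarrow> a (i + 1, j) + a (i, j + 1) - a (i + 1, j + 1)))}"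

lemma diagonal_solutions: "subspace diagonal_solutions" "dim diagonal_solutions = card (P - inner)"
proof -
  have *: "inner \<subseteq> P"
    by (auto simp: inner_def)
  have lin: "linear (\<lambda>a :: nat \<times> nat \<Rightarrow> real. case m of (i, j) \<Rightarrow> a (i + 1, j + 1))" for m
    by (rule linearI) (auto simp: scaleR_fun_apply split: prod.split)
  \<comment> \<open>The equation at \<open>m\<close> refers only to cells with a larger coordinate
    sum, hence the sign: the system is solved from the border inwards.\<close>
  let ?r = "\<lambda>(i, j). - int (i + j)"
  show "subspace diagonal_solutions" "dim diagonal_solutions = card (P - inner)"
    unfolding diagonal_solutions_def
    by (rule subspace_triangular_system[where r = ?r, OF finite_P * lin]
        dim_triangular_system[where r = ?r, OF finite_P * lin]; auto)+
qed

lemma square_solutions: "subspace square_solutions" "dim square_solutions = card (P - inner)"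
proof -
  have *: "inner \<subseteq> P"
    by (auto simp: inner_def)
  have lin: "linear (\<lambda>a :: nat \<times> nat \<Rightarrow> real.
      case m of (i, j) \<Rightarrow> a (i + 1, j) + a (i, j + 1) - a (i + 1, j + 1))" for m
    by (rule linearI) (auto simp: scaleR_fun_apply algebra_simps split: prod.split)
  let ?r = "\<lambda>(i, j). - int (i + j)"
  show "subspace square_solutions" "dim square_solutions = card (P - inner)"
    unfolding square_solutions_def
    by (rule subspace_triangular_system[where r = ?r, OF finite_P * lin]
        dim_triangular_system[where r = ?r, OF finite_P * lin]; auto)+
qed

text \<open>Since \<open>T = T\<^sup>+ - T\<^sup>-\<close>, here \<open>b = - a\<close>. The
  products then cancel exactly on diagonal solutions, and the indicators impose nothing because
  \<open>d\<close> can absorb them.\<close>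

lemma I_T_eq: "I_T P cell_le = toggle_combination ` diagonal_solutions"
proof (intro equalityI subsetI)
  fix f assume "f \<in> I_T P cell_le"
  then have "f \<in> span (ideal_indicator P cell_le ` P)"
    and span: "f \<in> span ({const_one P cell_le} \<union> toggle P cell_le ` P)"
    by (simp_all only: I_T_def Int_iff)
  then obtain d where d: "f = (\<Sum>p\<in>P. d p *\<^sub>R ideal_indicator P cell_le p)"
    unfolding span_image_finite[OF finite_P] by blast
  obtain a c where a: "\<forall>p. p \<notin> P \<longrightarrow> a p = 0"
    and f: "f = c *\<^sub>R const_one P cell_le + (\<Sum>p\<in>P. a p *\<^sub>R toggle P cell_le p)"
    using const_toggle_spanE[OF span] .
  have "k + A + - B + - D = 0" if "f = k + (A - B)" "f = D" for k A B D
    using that by (simp add: algebra_simps)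
  from this[OF f[unfolded sum_scaleR_toggle] d]
  have zero: "c *\<^sub>R const_one P cell_le + (\<Sum>p\<in>P. a p *\<^sub>R toggle_plus P cell_le p)
      + (\<Sum>p\<in>P. (- a p) *\<^sub>R toggle_minus P cell_le p)
      + (\<Sum>p\<in>P. (- d p) *\<^sub>R ideal_indicator P cell_le p) = 0"
    by (simp only: scaleR_minus_left sum_negf)
  have "c + a (1, 1) = 0 \<and> (\<forall>(i, j)\<in>inner. a (i + 1, j + 1) + - a (i, j) = 0) \<and>
      (\<forall>p\<in>P. linear_coeff a (\<lambda>p. - a p) (\<lambda>p. - d p) p = 0)"
    by (rule iffD1[OF combination_eq_0_iff zero]) (simp_all add: a)
  then have "c = - a (1, 1)" "\<forall>(i, j)\<in>inner. a (i + 1, j + 1) + - a (i, j) = 0"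
    by auto
  then have "f = toggle_combination a" "a \<in> diagonal_solutions"
    using a by (auto simp: f toggle_combination_def diagonal_solutions_def)
  then show "f \<in> toggle_combination ` diagonal_solutions"
    by blast
next
  fix f assume "f \<in> toggle_combination ` diagonal_solutions"
  then obtain a where f: "f = toggle_combination a" and a: "a \<in> diagonal_solutions"
    by blast
  \<comment> \<open>The indicator part of the toggle combination; subtracting it makes every linear
    coefficient 0.\<close>
  define d where "d = linear_coeff a (\<lambda>p. - a p) (\<lambda>p. 0)"
  have "linear_coeff a (\<lambda>p. - a p) (\<lambda>p. - d p) p = 0" for p
    unfolding d_def by (cases p) (simp add: linear_coeff_def)
  then have zero: "(- a (1, 1)) *\<^sub>R const_one P cell_le + (\<Sum>p\<in>P. a p *\<^sub>R toggle_plus P cell_le p)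
      + (\<Sum>p\<in>P. (- a p) *\<^sub>R toggle_minus P cell_le p)
      + (\<Sum>p\<in>P. (- d p) *\<^sub>R ideal_indicator P cell_le p) = 0"
    using a by (intro combination_eq_0_iff[THEN iffD2]) (auto simp: diagonal_solutions_def)
  have "A - B - k = D" if "- k + A + - B + - D = 0"
    for k A B D :: "(nat \<times> nat) set \<Rightarrow> real"
    using that by (simp add: algebra_simps)
  from this[OF zero[unfolded scaleR_minus_left sum_negf]]
  have "f = (\<Sum>p\<in>P. d p *\<^sub>R ideal_indicator P cell_le p)"
    by (simp only: f toggle_combination_def sum_scaleR_toggle)
  also have "\<dots> \<in> span (ideal_indicator P cell_le ` P)"
    by (intro span_sum span_scale span_base) auto
  finally show "f \<in> I_T P cell_le"
    using toggle_combination_in_span f by (auto simp: I_T_def)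
qed

text \<open>Cancellation of the products at the upper and left neighbours turns
  \<open>- b (i - 1, j)\<close> into \<open>a (i, j + 1)\<close> and \<open>- b (i, j - 1)\<close>
  into \<open>a (i + 1, j)\<close>; in the first row or column the conditional terms supply the same
  values. Assuming this only for smaller coordinate sums permits use inside an induction.\<close>

lemma linear_coeff_inner:
  assumes "(i, j) \<in> inner" and b: "\<And>p. p \<notin> P \<Longrightarrow> b p = 0"
    and "\<And>k l. (k, l) \<in> inner \<Longrightarrow> k + l < i + j \<Longrightarrow> a (k + 1, l + 1) + b (k, l) = 0"
  shows "linear_coeff a b d (i, j) = d (i, j) + b (i, j) - a (i, j) + a (i, j + 1) + a (i + 1, j)"
proof -
  have P: "(i, j) \<in> P" "(i + 1, j) \<in> P" "(i, j + 1) \<in> P"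
    using assms(1) by (auto simp: inner_def)
  then have ij: "1 \<le> i" "1 \<le> j"
    using pos by blast+
  have "- b (i - 1, j) + (if i = 1 then a (i, j + 1) else 0) = a (i, j + 1)"
  proof (cases "i = 1")
    case False
    then have "(i - 1, j) \<in> inner"
      using P ij down[of i j "i - 1" j] down[of i "j + 1" "i - 1" "j + 1"] by (auto simp: inner_def)
    then show ?thesis
      using assms(3)[of "i - 1" j] False ij by simp
  qed (simp add: b)
  moreover have "- b (i, j - 1) + (if j = 1 then a (i + 1, j) else 0) = a (i + 1, j)"
  proof (cases "j = 1")
    case False
    then have "(i, j - 1) \<in> inner"
      using P ij down[of i j i "j - 1"] down[of "i + 1" j "i + 1" "j - 1"] by (auto simp: inner_def)
    then show ?thesis
      using assms(3)[of i "j - 1"] False ij by simp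
  qed (simp add: b)
  ultimately show ?thesis
    by (simp add: linear_coeff_def)
qed

text \<open>Cancellation of the products gives \<open>b (i, j) = - a (i + 1, j + 1)\<close> at inner
  cells, and the linear coefficients there become the square relations. Conversely, the linear
  equations determine \<open>b\<close>, and the square relations make the products cancel.\<close>

lemma A_T_eq: "A_T P cell_le = toggle_combination ` square_solutions"
proof (intro equalityI subsetI)
  fix f assume "f \<in> A_T P cell_le"
  then have "f \<in> span (toggle_minus P cell_le ` P)"
    and span: "f \<in> span ({const_one P cell_le} \<union> toggle P cell_le ` P)"
    by (simp_all only: A_T_def Int_iff)
  then obtain d where d: "f = (\<Sum>p\<in>P. d p *\<^sub>R toggle_minus P cell_le p)"
    and d0: "\<forall>p. p \<notin> P \<longrightarrow> d p = 0"
    unfolding span_image_finite[OF finite_P] by blast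
  obtain a c where a: "\<forall>p. p \<notin> P \<longrightarrow> a p = 0"
    and f: "f = c *\<^sub>R const_one P cell_le + (\<Sum>p\<in>P. a p *\<^sub>R toggle P cell_le p)"
    using const_toggle_spanE[OF span] .
  \<comment> \<open>The total coefficient of \<open>T\<^sup>-\<close> once
    \<open>\<Sum>p. d p * T\<^sup>- p\<close> is moved to the other side.\<close>
  define b where "b p = - a p - d p" for p
  have b: "b p = 0" if "p \<notin> P" for p
    using that a d0 by (cases p) (simp add: b_def)
  have "k + A + (- B - D) = 0" if "f = k + (A - B)" "f = D" for k A B D
    using that by (simp add: algebra_simps)
  from this[OF f[unfolded sum_scaleR_toggle] d]
  have zero: "c *\<^sub>R const_one P cell_le + (\<Sum>p\<in>P. a p *\<^sub>R toggle_plus P cell_le p)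
      + (\<Sum>p\<in>P. b p *\<^sub>R toggle_minus P cell_le p)
      + (\<Sum>p\<in>P. 0 *\<^sub>R ideal_indicator P cell_le p) = 0"
    by (simp only: b_def scaleR_left_diff_distrib scaleR_minus_left sum_subtractf sum_negf
        scaleR_zero_left sum.neutral_const add_0_right)
  have "c + a (1, 1) = 0 \<and> (\<forall>(i, j)\<in>inner. a (i + 1, j + 1) + b (i, j) = 0) \<and>
      (\<forall>p\<in>P. linear_coeff a b (\<lambda>_. 0) p = 0)"
    by (rule iffD1[OF combination_eq_0_iff zero]) (simp_all add: a b)
  then have c: "c = - a (1, 1)" and inner: "\<forall>(i, j)\<in>inner. a (i + 1, j + 1) + b (i, j) = 0"
    and "\<forall>p\<in>P. linear_coeff a b (\<lambda>_. 0) p = 0"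
    by auto
  have "a (i, j) = a (i + 1, j) + a (i, j + 1) - a (i + 1, j + 1)" if "(i, j) \<in> inner" for i j
  proof -
    have "linear_coeff a b (\<lambda>_. 0) (i, j) = 0"
      using that \<open>\<forall>p\<in>P. linear_coeff a b (\<lambda>_. 0) p = 0\<close> by (auto simp: inner_def)
    moreover have "linear_coeff a b (\<lambda>_. 0) (i, j) =
        0 + b (i, j) - a (i, j) + a (i, j + 1) + a (i + 1, j)"
      by (rule linear_coeff_inner[OF that b]) (use inner in auto)
    moreover have "a (i + 1, j + 1) + b (i, j) = 0"
      using that inner by blast
    ultimately show ?thesis
      by linarith
  qed
  then have "f = toggle_combination a" "a \<in> square_solutions"
    using a by (auto simp: f c toggle_combination_def square_solutions_def)
  then show "f \<in> toggle_combination ` square_solutions"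
    by blast
next
  fix f assume "f \<in> toggle_combination ` square_solutions"
  then obtain a where f: "f = toggle_combination a" and a: "a \<in> square_solutions"
    by blast
  have a0: "\<And>p. p \<notin> P \<Longrightarrow> a p = 0"
    and sq: "\<And>i j. (i, j) \<in> inner \<Longrightarrow> a (i, j) = a (i + 1, j) + a (i, j + 1) - a (i + 1, j + 1)"
    using a by (auto simp: square_solutions_def)
  \<comment> \<open>The equation \<open>linear_coeff a b (\<lambda>_. 0) (i, j) = 0\<close> solved
    for \<open>b (i, j)\<close>. It refers to the upper and left neighbours, so this system is
    solved outwards from \<open>(1, 1)\<close>.\<close>
  define L where "L = (\<lambda>(i, j) b. a (i, j) + b (i - 1, j) + b (i, j - 1)
     - (if i = 1 then a (i, j + 1) else 0) - (if j = 1 then a (i + 1, j) else 0))"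
  obtain b where b: "\<And>p. p \<notin> P \<Longrightarrow> b p = 0" and bL: "\<And>p. p \<in> P \<Longrightarrow> b p = L p b"
  proof -
    have "\<exists>b. (\<forall>p. p \<notin> P \<longrightarrow> b p = (\<lambda>_. 0) p) \<and> (\<forall>p\<in>P. b p = L p b)"
    proof (rule triangular_system_solvable[where r = "\<lambda>(i, j). int (i + j)", OF finite_P])
      fix m and b b' :: "nat \<times> nat \<Rightarrow> real"
      assume "m \<in> P" and eq: "\<And>p. (case p of (i, j) \<Rightarrow> int (i + j)) < (case m of (i, j) \<Rightarrow> int (i + j))
        \<Longrightarrow> b p = b' p"
      obtain i j where m: "m = (i, j)"
        by fastforce
      then have "1 \<le> i" "1 \<le> j"
        using \<open>m \<in> P\<close> pos by auto
      then show "L m b = L m b'"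
        using eq[of "(i - 1, j)"] eq[of "(i, j - 1)"] by (simp add: L_def m)
    qed
    then show thesis
      using that by blast
  qed
  have coeff: "linear_coeff a b (\<lambda>_. 0) p = 0" if "p \<in> P" for p
    using bL[OF that] by (cases p) (simp add: linear_coeff_def L_def)
  \<comment> \<open>Only the linear coefficients were made 0 by the choice of \<open>b\<close>; the
    products cancel by induction on the coordinate sum, through the square relations.\<close>
  have inner: "a (i + 1, j + 1) + b (i, j) = 0" if "(i, j) \<in> inner" for i j
    using that
  proof (induction "i + j" arbitrary: i j rule: less_induct)
    case less
    have "linear_coeff a b (\<lambda>_. 0) (i, j) = 0 + b (i, j) - a (i, j) + a (i, j + 1) + a (i + 1, j)"
      by (rule linear_coeff_inner[OF less.prems b]) (use less.hyps in auto)
    moreover have "linear_coeff a b (\<lambda>_. 0) (i, j) = 0"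
      using coeff less.prems by (auto simp: inner_def)
    ultimately show ?case
      using sq[OF less.prems] by linarith
  qed
  have zero: "(- a (1, 1)) *\<^sub>R const_one P cell_le + (\<Sum>p\<in>P. a p *\<^sub>R toggle_plus P cell_le p)
      + (\<Sum>p\<in>P. b p *\<^sub>R toggle_minus P cell_le p)
      + (\<Sum>p\<in>P. 0 *\<^sub>R ideal_indicator P cell_le p) = 0"
    using a0 b inner coeff by (intro combination_eq_0_iff[THEN iffD2]) auto
  have "A - B - k = - (B + D)" if "- k + A + D + 0 = 0"
    for k A B D :: "(nat \<times> nat) set \<Rightarrow> real"
  proof -
    have "A - B - k = (- k + A + D + 0) - (B + D)"
      by (simp add: algebra_simps)
    then show ?thesis
      unfolding that by simp
  qed
  from this[OF zero[unfolded scaleR_minus_left scaleR_zero_left sum.neutral_const]]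
  have "f = - (\<Sum>p\<in>P. (a p + b p) *\<^sub>R toggle_minus P cell_le p)"
    by (simp only: f toggle_combination_def scaleR_left_distrib sum.distrib sum_scaleR_toggle)
  also have "\<dots> \<in> span (toggle_minus P cell_le ` P)"
    by (intro span_neg span_sum span_scale span_base) auto
  finally show "f \<in> A_T P cell_le"
    using toggle_combination_in_span f by (auto simp: A_T_def)
qed

lemma dim_I_T: "dim (I_T P cell_le) = card (P - inner)"
proof -
  have "inj_on toggle_combination diagonal_solutions"
    by (rule inj_on_toggle_combination[OF diagonal_solutions(1)]) (use diagonal_solutions_def in blast)
  then show ?thesis
    unfolding I_T_eq using diagonal_solutions(2)
    by (simp only: dim_image_inj_on[OF linear_toggle_combination diagonal_solutions(1)])
qed

lemma dim_A_T: "dim (A_T P cell_le) = card (P - inner)"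
proof -
  have "inj_on toggle_combination square_solutions"
    by (rule inj_on_toggle_combination[OF square_solutions(1)]) (use square_solutions_def in blast)
  then show ?thesis
    unfolding A_T_eq using square_solutions(2)
    by (simp only: dim_image_inj_on[OF linear_toggle_combination square_solutions(1)])
qed

end

section \<open>Ferrers diagrams and the count of cells\<close>

lemma young_diagram_ferrers:
  assumes "integer_partition lam"
  shows "young_diagram (ferrers lam)"
proof
  show "finite (ferrers lam)"
    by (rule finite_ferrers)
next
  fix i j assume "(i, j) \<in> ferrers lam"
  then show "1 \<le> i \<and> 1 \<le> j"
    by (simp add: ferrers_def)
next
  fix i j i' j'
  assume *: "(i, j) \<in> ferrers lam" "1 \<le> i'" "i' \<le> i" "1 \<le> j'" "j' \<le> j"
  have "lam ! (i - 1) \<le> lam ! (i' - 1)"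
  proof (cases "i' = i")
    case False
    then have "i' - 1 < i - 1" "i - 1 < length lam"
      using * by (auto simp: ferrers_def)
    then show ?thesis
      using assms sorted_wrt_nth_less[of "(\<ge>)" lam "i' - 1" "i - 1"]
      by (simp add: integer_partition_def)
  qed simp
  then show "(i', j') \<in> ferrers lam"
    using * by (auto simp: ferrers_def)
qed

theorem theorem3p16:
  fixes lam :: "nat list"
  assumes "integer_partition lam"
  shows "dim (I_T (ferrers lam) cell_le) = dim (A_T (ferrers lam) cell_le) \<and>
         int (dim (A_T (ferrers lam) cell_le)) =
           int (card (border_strip lam)) - int (card (corner_cells lam))"
proof -
  interpret young_diagram "ferrers lam"
    using assms by (rule young_diagram_ferrers)
  have "p \<in> border_strip lam" if "p \<in> ferrers lam" "p \<notin> inner" for p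
  proof -
    obtain i j where p: "p = (i, j)"
      by fastforce
    \<comment> \<open>If the diagonal neighbour were in the diagram, both neighbours would be too
      and the cell would be inner.\<close>
    have "(i + 1, j + 1) \<notin> ferrers lam"
      using that pos[of i j] down[of "i + 1" "j + 1" "i + 1" j] down[of "i + 1" "j + 1" i "j + 1"]
      by (auto simp: inner_def p)
    then show ?thesis
      using that by (simp add: border_strip_def p)
  qed
  then have outer: "ferrers lam - inner \<subseteq> border_strip lam"
    by blast
  \<comment> \<open>For a border cell, neighbours in the diagram are automatically border cells: a
    diagonal neighbour of either would force \<open>(i + 1, j + 1)\<close> into the diagram.\<close>
  have corner: "corner_cells lam = border_strip lam \<inter> inner"
  proof (rule set_eqI)
    fix p :: "nat \<times> nat"
    obtain i j where p: "p = (i, j)"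
      by fastforce
    show "p \<in> corner_cells lam \<longleftrightarrow> p \<in> border_strip lam \<inter> inner"
      using down[of "i + 2" "j + 1" "i + 1" "j + 1"] down[of "i + 1" "j + 2" "i + 1" "j + 1"]
      by (auto simp: inner_def border_strip_def corner_cells_def p)
  qed
  have "ferrers lam - inner = border_strip lam - corner_cells lam"
    using outer unfolding corner by (auto simp: border_strip_def)
  moreover have "corner_cells lam \<subseteq> border_strip lam"
    using corner by blast
  ultimately have "int (card (ferrers lam - inner)) =
      int (card (border_strip lam)) - int (card (corner_cells lam))"
    using finite_border_strip[of lam]
    by (simp add: card_Diff_subset finite_subset card_mono of_nat_diff)
  then show ?thesis
    by (simp add: dim_I_T dim_A_T)
qed

end
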